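(* Let $A\in \operatorname{GL}(n,\mathbb{C})$ be a diagonal linear operator (i.e. diagonal in some basis of $\mathbb{C}^n$) with eigenvalues $\alpha_1,\dots,\alpha_n$, and let $A_1$ be the operator which is diagonal in the same basis, with eigenvalues $|\alpha_1|,\dots,|\alpha_n|$ respectively. Denote by $\mathcal{G}$ the Zariski closure of the group $\langle A\rangle=\{A^m: m\in\mathbb{Z}\}$ in $\operatorname{GL}(n,\mathbb{C})$. Then $\mathcal{G}$ contains $A_1$.
   Context: The Zariski closure is taken in $\operatorname{GL}(n,\mathbb{C})$ viewed as an algebraic group over $\mathbb{C}$; it is the smallest complex algebraic subgroup containing $\langle A\rangle$. *)

theory Defs
  imports "HOL-Analysis.Analysis" "HOL-Algebra.Group"
begin

definition GL :: "(complex^'n^'n) monoid" where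
  "GL = \<lparr>carrier = {X. invertible X}, mult = (**), one = mat 1\<rparr>"

lemma group_GL: "group (GL :: (complex^'n^'n) monoid)"
proof (rule groupI)
  fix X :: "complex^'n^'n" assume "X \<in> carrier GL"
  then obtain Y where "X ** Y = mat 1" "Y ** X = mat 1"
    by (auto simp: GL_def invertible_def)
  then show "\<exists>Y\<in>carrier GL. Y \<otimes>\<^bsub>GL\<^esub> X = \<one>\<^bsub>GL\<^esub>"
    by (auto simp: GL_def invertible_def)
qed (auto simp: GL_def invertible_mult matrix_mul_assoc intro: exI[of _ "mat 1"] simp: invertible_def[of "mat 1"])

text \<open>The coordinate ring of the affine variety GL(n), generated over the complex numbers by
  the matrix entries and the inverse of the determinant. Its elements are represented by functions
  on all matrices, of which only the values on invertible matrices are ever used.\<close>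

inductive_set regular_functions :: "(complex^'n^'n \<Rightarrow> complex) set" where
  const: "(\<lambda>X. c) \<in> regular_functions"
| entry: "(\<lambda>X. X $ i $ j) \<in> regular_functions"
| inv_det: "(\<lambda>X. inverse (det X)) \<in> regular_functions"
| add: "f \<in> regular_functions \<Longrightarrow> g \<in> regular_functions \<Longrightarrow> (\<lambda>X. f X + g X) \<in> regular_functions"
| mult: "f \<in> regular_functions \<Longrightarrow> g \<in> regular_functions \<Longrightarrow> (\<lambda>X. f X * g X) \<in> regular_functions"

definition zero_locus :: "(complex^'n^'n \<Rightarrow> complex) set \<Rightarrow> (complex^'n^'n) set" where
  "zero_locus F = {X \<in> carrier GL. \<forall>f\<in>F. f X = 0}"

definition zariski_GL :: "(complex^'n^'n) topology" where
  "zariski_GL = topology (\<lambda>U. \<exists>F\<subseteq>regular_functions. U = carrier GL - zero_locus F)"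

lemma istopology_zariski_GL:
  "istopology (\<lambda>U :: (complex^'n^'n) set. \<exists>F\<subseteq>regular_functions. U = carrier GL - zero_locus F)"
  unfolding istopology_def
proof (intro conjI allI impI)
  fix S T :: "(complex^'n^'n) set"
  assume "\<exists>F\<subseteq>regular_functions. S = carrier GL - zero_locus F"
    and "\<exists>F\<subseteq>regular_functions. T = carrier GL - zero_locus F"
  then obtain F G where F: "F \<subseteq> regular_functions" "S = carrier GL - zero_locus F"
    and G: "G \<subseteq> regular_functions" "T = carrier GL - zero_locus G"
    by blast
  let ?H = "{\<lambda>X. f X * g X |f g. f \<in> F \<and> g \<in> G}"
  have "?H \<subseteq> regular_functions"
    using F(1) G(1) by (auto intro: regular_functions.mult)
  moreover have "S \<inter> T = carrier GL - zero_locus ?H"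
    unfolding F(2) G(2) zero_locus_def by (fastforce)
  ultimately show "\<exists>F\<subseteq>regular_functions. S \<inter> T = carrier GL - zero_locus F"
    by blast
next
  fix K :: "(complex^'n^'n) set set"
  assume "\<forall>S\<in>K. \<exists>F\<subseteq>regular_functions. S = carrier GL - zero_locus F"
  then obtain F where F: "\<And>S. S \<in> K \<Longrightarrow> F S \<subseteq> regular_functions"
    "\<And>S. S \<in> K \<Longrightarrow> S = carrier GL - zero_locus (F S)"
    by metis
  have "\<Union>K = (\<Union>S\<in>K. carrier GL - zero_locus (F S))"
    using F(2) by auto
  also have "\<dots> = carrier GL - zero_locus (\<Union>S\<in>K. F S)"
    unfolding zero_locus_def by blast
  finally show "\<exists>F\<subseteq>regular_functions. \<Union>K = carrier GL - zero_locus F"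
    using F(1) by (intro exI[of _ "\<Union>S\<in>K. F S"]) blast
qed

lemma openin_zariski_GL:
  "openin zariski_GL U \<longleftrightarrow> (\<exists>F\<subseteq>regular_functions. U = carrier GL - zero_locus F)"
  unfolding zariski_GL_def by (simp add: topology_inverse'[OF istopology_zariski_GL])

lemma topspace_zariski_GL: "topspace zariski_GL = carrier GL"
proof
  show "topspace zariski_GL \<subseteq> carrier GL"
    unfolding topspace_def by (auto simp: openin_zariski_GL)
  have "openin zariski_GL (carrier GL)"
    unfolding openin_zariski_GL
    by (intro exI[of _ "{\<lambda>X. 1}"]) (auto simp: zero_locus_def intro: regular_functions.const)
  then show "carrier GL \<subseteq> topspace zariski_GL"
    by (rule openin_subset)
qed

lemma closedin_zariski_GL:
  "closedin zariski_GL Z \<longleftrightarrow> (\<exists>F\<subseteq>regular_functions. Z = zero_locus F)"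
proof -
  have sub: "zero_locus F \<subseteq> carrier GL" for F :: "(complex^'n^'n \<Rightarrow> complex) set"
    by (auto simp: zero_locus_def)
  have "Z \<subseteq> carrier GL \<and> carrier GL - Z = carrier GL - zero_locus F \<longleftrightarrow> Z = zero_locus F" for F
    using sub[of F] by blast
  then show ?thesis
    unfolding closedin_def topspace_zariski_GL openin_zariski_GL by metis
qed

definition is_basis :: "('n \<Rightarrow> complex^'n) \<Rightarrow> bool" where
  "is_basis b \<longleftrightarrow> inj b \<and> vec.independent (range b) \<and> vec.span (range b) = UNIV"

definition diagonal_in_basis ::
    "('n \<Rightarrow> complex^'n) \<Rightarrow> ('n \<Rightarrow> complex) \<Rightarrow> complex^'n^'n \<Rightarrow> bool" where
  "diagonal_in_basis b \<alpha> X \<longleftrightarrow> (\<forall>i. X *v b i = \<alpha> i *s b i)"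

end

theory Submission
  imports Defs "HOL-Computational_Algebra.Polynomial"
begin

text \<open>
  For a multiplicative map \<open>\<phi>\<close> of the complex numbers let \<open>D \<phi>\<close> be the operator that is diagonal in
  the basis with eigenvalues \<open>\<phi> (\<alpha> i)\<close>. Then \<open>A ^ m\<close> is \<open>D \<phi>\<close> for \<open>\<phi> z = z ^ m\<close>, and \<open>A\<^sub>1\<close> is
  \<open>D \<phi>\<close> for \<open>\<phi> z = \<bar>z\<bar>\<close>. A regular function \<open>f\<close> satisfies \<open>f (D \<phi>) = (\<Sum>k. c k * \<phi> (v k))\<close>
  with finitely many \<open>c k\<close> and \<open>v k\<close> that do not depend on \<open>\<phi>\<close>. If \<open>f\<close> vanishes on all powers of
  \<open>A\<close>, then \<open>\<Sum>k. c k * p (v k)\<close> vanishes for every polynomial \<open>p\<close>, in particular for one that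
  interpolates the absolute value at the points \<open>v k\<close>; so \<open>f\<close> vanishes at \<open>A\<^sub>1\<close>.
\<close>

section \<open>Interpolation and vanishing power sums\<close>

lemma exists_interpolating_poly:
  fixes h :: "'a::field \<Rightarrow> 'a"
  assumes "finite V"
  shows "\<exists>p. \<forall>v\<in>V. poly p v = h v"
  using assms
proof induction
  case (insert x V)
  then obtain p where p: "\<forall>v\<in>V. poly p v = h v" by blast
  define q where "q = (\<Prod>u\<in>V. [:- u, 1:])"
  have "poly q v = 0" if "v \<in> V" for v
    using insert.hyps that by (auto simp: q_def poly_prod)
  moreover have "poly q x \<noteq> 0"
    using insert.hyps by (auto simp: q_def poly_prod)
  ultimately show ?case
    \<comment> \<open>Since \<open>q\<close> vanishes on \<open>V\<close> but not at
      \<open>x\<close>, adding a multiple of it corrects the value at \<open>x\<close> and leaves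
      those on \<open>V\<close> unchanged.\<close>
    using p by (intro exI[of _ "p + smult ((h x - poly p x) / poly q x) q"]) auto
qed simp

text \<open>The points \<open>v\<close> may repeat in \<open>L\<close>, so the single coefficients
  need not vanish; interpolating \<open>h\<close> on the points avoids collecting equal
  ones.\<close>

lemma sum_list_exponentials_eq_0:
  fixes L :: "('a::field \<times> 'a) list"
  assumes "\<And>m::nat. (\<Sum>(c, v)\<leftarrow>L. c * v ^ m) = 0"
  shows "(\<Sum>(c, v)\<leftarrow>L. c * h v) = 0"
proof -
  obtain p where p: "\<forall>v\<in>snd ` set L. poly p v = h v"
    using exists_interpolating_poly[of "snd ` set L" h] by auto
  have "(\<Sum>(c, v)\<leftarrow>L. c * h v) = (\<Sum>(c, v)\<leftarrow>L. c * poly p v)"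
    using p by (intro arg_cong[where f = sum_list] map_cong) force+
  also have "\<dots> = (\<Sum>(c, v)\<leftarrow>L. \<Sum>m\<le>degree p. coeff p m * (c * v ^ m))"
    by (simp add: poly_altdef sum_distrib_left mult_ac)
  also have "\<dots> = (\<Sum>m\<le>degree p. coeff p m * (\<Sum>(c, v)\<leftarrow>L. c * v ^ m))"
    by (induction L) (auto simp: sum.distrib distrib_left)
  finally show ?thesis
    using assms by simp
qed

section \<open>Change of basis for diagonal operators\<close>

definition basis_matrix :: "('n \<Rightarrow> complex^'n) \<Rightarrow> complex^'n^'n" where
  "basis_matrix b = (\<chi> i j. b j $ i)"

definition diag_matrix :: "('n \<Rightarrow> complex) \<Rightarrow> complex^'n^'n" where
  "diag_matrix \<beta> = (\<chi> i j. if i = j then \<beta> i else 0)"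

lemma invertible_basis_matrix:
  assumes "is_basis b"
  shows "invertible (basis_matrix b)"
proof -
  have "columns (basis_matrix b) = range b"
    by (auto simp: columns_def column_def basis_matrix_def image_def)
  then have "\<exists>B. basis_matrix b ** B = mat 1"
    using assms matrix_right_invertible_span_columns[of "basis_matrix b"]
    by (simp add: is_basis_def)
  then show ?thesis
    using invertible_right_inverse by blast
qed

lemma diagonal_in_basis_mult_basis_matrix:
  assumes "diagonal_in_basis b \<beta> D"
  shows "D ** basis_matrix b = basis_matrix b ** diag_matrix \<beta>"
proof -
  have "(D ** basis_matrix b) $ i $ j = (basis_matrix b ** diag_matrix \<beta>) $ i $ j" for i j
  proof -
    have "(D ** basis_matrix b) $ i $ j = (D *v b j) $ i"
      by (simp add: matrix_matrix_mult_def matrix_vector_mult_def basis_matrix_def)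
    also have "\<dots> = \<beta> j * b j $ i"
      using assms by (simp add: diagonal_in_basis_def)
    also have "\<dots> = (basis_matrix b ** diag_matrix \<beta>) $ i $ j"
      by (simp add: matrix_matrix_mult_def basis_matrix_def diag_matrix_def if_distrib cong: if_cong)
    finally show ?thesis .
  qed
  then show ?thesis
    by (simp add: vec_eq_iff)
qed

lemma diagonal_in_basis_det:
  assumes "is_basis b" "diagonal_in_basis b \<beta> D"
  shows "det D = (\<Prod>i\<in>UNIV. \<beta> i)"
proof -
  have "det D * det (basis_matrix b) = det (basis_matrix b) * det (diag_matrix \<beta>)"
    using arg_cong[OF diagonal_in_basis_mult_basis_matrix[OF assms(2)], of det]
    by (simp add: det_mul)
  moreover have "det (basis_matrix b) \<noteq> 0"
    using invertible_basis_matrix[OF assms(1)] by (simp add: invertible_det_nz)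
  moreover have "det (diag_matrix \<beta>) = (\<Prod>i\<in>UNIV. \<beta> i)"
    by (subst det_diagonal) (auto simp: diag_matrix_def)
  ultimately show ?thesis by simp
qed

text \<open>With \<open>P\<close> the basis matrix and \<open>Q\<close> its inverse,
  \<open>D\<close> is \<open>P ** diag_matrix \<beta> ** Q\<close>. The coefficients
  \<open>P $ i $ k * Q $ k $ j\<close> come from the basis alone, so one \<open>c\<close> serves all
  \<open>D\<close>.\<close>

lemma diagonal_in_basis_entry:
  assumes "is_basis b"
  obtains c where "\<And>\<beta> D. diagonal_in_basis b \<beta> D \<Longrightarrow> D $ i $ j = (\<Sum>k\<in>UNIV. c k * \<beta> k)"
proof -
  obtain Q where Q: "basis_matrix b ** Q = mat 1"
    using invertible_basis_matrix[OF assms] by (auto simp: invertible_def)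
  have "D $ i $ j = (\<Sum>k\<in>UNIV. (basis_matrix b $ i $ k * Q $ k $ j) * \<beta> k)"
    if "diagonal_in_basis b \<beta> D" for \<beta> D
  proof -
    have "D = D ** (basis_matrix b ** Q)"
      by (simp add: Q)
    also have "\<dots> = basis_matrix b ** (diag_matrix \<beta> ** Q)"
      by (simp add: matrix_mul_assoc diagonal_in_basis_mult_basis_matrix[OF that])
    finally have "D $ i $ j = (basis_matrix b ** (diag_matrix \<beta> ** Q)) $ i $ j"
      by simp
    moreover have "(diag_matrix \<beta> ** Q) $ k $ j = \<beta> k * Q $ k $ j" for k
      by (simp add: matrix_matrix_mult_def diag_matrix_def if_distrib[where f = "\<lambda>x. x * _"]
          cong: if_cong)
    ultimately show ?thesis
      by (simp add: matrix_matrix_mult_def[of "basis_matrix b"] mult_ac)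
  qed
  then show thesis by (rule that)
qed

lemma diagonal_in_basis_pow:
  fixes m :: nat
  assumes "diagonal_in_basis b \<alpha> A"
  shows "diagonal_in_basis b (\<lambda>i. \<alpha> i ^ m) (A [^]\<^bsub>GL\<^esub> m)"
proof (induction m)
  case 0
  show ?case by (simp add: diagonal_in_basis_def GL_def)
next
  case (Suc m)
  have "A [^]\<^bsub>GL\<^esub> Suc m = A [^]\<^bsub>GL\<^esub> m ** A"
    by (simp add: GL_def)
  with Suc assms show ?case
    by (simp add: diagonal_in_basis_def vector_scalar_commute mult.commute
        del: nat_pow_Suc matrix_vector_mul_assoc flip: matrix_vector_mul_assoc)
qed

section \<open>Regular functions on diagonal operators\<close>

definition multiplicative :: "('a::monoid_mult \<Rightarrow> 'b::monoid_mult) \<Rightarrow> bool" where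
  "multiplicative \<phi> \<longleftrightarrow> \<phi> 1 = 1 \<and> (\<forall>x y. \<phi> (x * y) = \<phi> x * \<phi> y)"

lemma multiplicative_prod:
  fixes \<phi> :: "'a::comm_monoid_mult \<Rightarrow> 'b::comm_monoid_mult"
  assumes "multiplicative \<phi>"
  shows "\<phi> (\<Prod>i\<in>I. g i) = (\<Prod>i\<in>I. \<phi> (g i))"
  using assms by (induction I rule: infinite_finite_induct) (auto simp: multiplicative_def)

lemma multiplicative_inverse:
  fixes \<phi> :: "'a::field \<Rightarrow> 'b::field"
  assumes "multiplicative \<phi>" "x \<noteq> 0"
  shows "\<phi> (inverse x) = inverse (\<phi> x)"
proof -
  have "\<phi> x * \<phi> (inverse x) = 1"
    using assms unfolding multiplicative_def by (metis right_inverse)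
  then show ?thesis by (metis inverse_unique)
qed

text \<open>Multiplying out gives one term for each pair, and \<phi> merges the two points into
  \<open>v * w\<close>.\<close>

lemma sum_list_product_characters:
  fixes \<phi> :: "'a::comm_semiring_1 \<Rightarrow> 'a"
  assumes "multiplicative \<phi>"
  shows "(\<Sum>(c, v)\<leftarrow>[(c * d, v * w). (c, v) \<leftarrow> L, (d, w) \<leftarrow> M]. c * \<phi> v)
    = (\<Sum>(c, v)\<leftarrow>L. c * \<phi> v) * (\<Sum>(d, w)\<leftarrow>M. d * \<phi> w)"
proof -
  have *: "(\<Sum>(c, v)\<leftarrow>[(c * d, v * w). (d, w) \<leftarrow> M]. c * \<phi> v)
      = c * \<phi> v * (\<Sum>(d, w)\<leftarrow>M. d * \<phi> w)" for c v
    using assms by (induction M) (auto simp: multiplicative_def algebra_simps)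
  then show ?thesis
    by (induction L) (auto simp: algebra_simps)
qed

text \<open>Induction over the generators: a constant sits at the point 1, an entry uses the points
  \<open>\<alpha> k\<close>, and the inverse determinant sits at the inverse of the product of the
  eigenvalues. Sums append lists; products pair their terms.\<close>

lemma regular_function_on_diagonal:
  fixes b :: "'n \<Rightarrow> complex^'n" and \<alpha> :: "'n \<Rightarrow> complex"
  assumes "f \<in> regular_functions" "is_basis b" "\<And>i. \<alpha> i \<noteq> 0"
  shows "\<exists>L. \<forall>\<phi> D. multiplicative \<phi> \<longrightarrow> diagonal_in_basis b (\<lambda>i. \<phi> (\<alpha> i)) D \<longrightarrow>
    f D = (\<Sum>(c, v)\<leftarrow>L. c * \<phi> v)"
  using assms(1)
proof induction
  case (const c)
  show ?case
    by (rule exI[of _ "[(c, 1)]"]) (simp add: multiplicative_def)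
next
  case (entry i j)
  obtain c where c: "\<And>\<beta> D. diagonal_in_basis b \<beta> D \<Longrightarrow> D $ i $ j = (\<Sum>k\<in>UNIV. c k * \<beta> k)"
    using diagonal_in_basis_entry[OF assms(2)] by blast
  \<comment> \<open>Enumerating the index type turns the sum over \<open>UNIV\<close> into a sum
    over a list.\<close>
  obtain ks :: "'n list" where ks: "set ks = UNIV" "distinct ks"
    using finite_distinct_list[OF finite_class.finite_UNIV] by blast
  have "(\<Sum>k\<in>UNIV. g k) = (\<Sum>k\<leftarrow>ks. g k)" for g :: "'n \<Rightarrow> complex"
    using ks sum_list_distinct_conv_sum_set by metis
  then show ?case
    by (intro exI[of _ "map (\<lambda>k. (c k, \<alpha> k)) ks"]) (simp add: c o_def)
next
  case inv_det
  have "(\<Prod>i\<in>UNIV. \<alpha> i) \<noteq> 0"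
    using assms(3) by simp
  then show ?case
    by (intro exI[of _ "[(1, inverse (\<Prod>i\<in>UNIV. \<alpha> i))]"])
      (simp add: diagonal_in_basis_det[OF assms(2)] multiplicative_inverse multiplicative_prod)
next
  case (add f g)
  then obtain L M where
    "\<forall>\<phi> D. multiplicative \<phi> \<longrightarrow> diagonal_in_basis b (\<lambda>i. \<phi> (\<alpha> i)) D \<longrightarrow>
      f D = (\<Sum>(c, v)\<leftarrow>L. c * \<phi> v)"
    "\<forall>\<phi> D. multiplicative \<phi> \<longrightarrow> diagonal_in_basis b (\<lambda>i. \<phi> (\<alpha> i)) D \<longrightarrow>
      g D = (\<Sum>(c, v)\<leftarrow>M. c * \<phi> v)"
    by blast
  then show ?case
    by (intro exI[of _ "L @ M"]) simp
next
  case (mult f g)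
  then obtain L M where
    "\<forall>\<phi> D. multiplicative \<phi> \<longrightarrow> diagonal_in_basis b (\<lambda>i. \<phi> (\<alpha> i)) D \<longrightarrow>
      f D = (\<Sum>(c, v)\<leftarrow>L. c * \<phi> v)"
    "\<forall>\<phi> D. multiplicative \<phi> \<longrightarrow> diagonal_in_basis b (\<lambda>i. \<phi> (\<alpha> i)) D \<longrightarrow>
      g D = (\<Sum>(c, v)\<leftarrow>M. c * \<phi> v)"
    by blast
  then show ?case
    by (intro exI[of _ "[(c * d, v * w). (c, v) \<leftarrow> L, (d, w) \<leftarrow> M]"] allI impI)
      (simp only: sum_list_product_characters)
qed

section \<open>The Zariski closure in terms of regular functions\<close>

lemma in_zariski_closure_iff:
  assumes "S \<subseteq> carrier GL"
  shows "X \<in> zariski_GL closure_of S \<longleftrightarrow>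
    X \<in> carrier GL \<and> (\<forall>f\<in>regular_functions. (\<forall>Y\<in>S. f Y = 0) \<longrightarrow> f X = 0)" (is "?L \<longleftrightarrow> ?R")
proof
  assume X: ?L
  have "f X = 0" if "f \<in> regular_functions" "\<forall>Y\<in>S. f Y = 0" for f
  proof -
    \<comment> \<open>The zeros of \<open>f\<close> form a closed set containing \<open>S\<close>,
      hence containing its closure.\<close>
    have "closedin zariski_GL (zero_locus {f})"
      unfolding closedin_zariski_GL using that(1) by blast
    moreover have "S \<subseteq> zero_locus {f}"
      using assms that(2) by (auto simp: zero_locus_def)
    ultimately have "X \<in> zero_locus {f}"
      using X closure_of_minimal by blast
    then show ?thesis by (simp add: zero_locus_def)
  qed
  moreover have "X \<in> carrier GL"
    using X by (metis in_closure_of topspace_zariski_GL)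
  ultimately show ?R by blast
next
  assume X: ?R
  \<comment> \<open>The closure is itself the zero locus of some \<open>F\<close>; every member of
    \<open>F\<close> vanishes on \<open>S\<close>, and so at \<open>X\<close>.\<close>
  obtain F where F: "F \<subseteq> regular_functions" "zariski_GL closure_of S = zero_locus F"
    using closedin_closure_of[of zariski_GL S] unfolding closedin_zariski_GL by blast
  have "S \<subseteq> zero_locus F"
    using closure_of_subset[of S zariski_GL] assms F(2) by (simp add: topspace_zariski_GL)
  then show ?L
    unfolding F(2) using X F(1) unfolding zero_locus_def by blast
qed

theorem theorem4p3:
  fixes A A\<^sub>1 :: "complex^'n^'n"
    and b :: "'n \<Rightarrow> complex^'n"
    and \<alpha> :: "'n \<Rightarrow> complex"
  assumes "A \<in> carrier GL"
    and "is_basis b"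
    and "diagonal_in_basis b \<alpha> A"
    and "diagonal_in_basis b (\<lambda>i. complex_of_real (cmod (\<alpha> i))) A\<^sub>1"
  shows "A\<^sub>1 \<in> zariski_GL closure_of {A [^]\<^bsub>GL\<^esub> m |m :: int. True}"
proof -
  \<comment> \<open>The product of the eigenvalues is the determinant of the invertible
    \<open>A\<close>.\<close>
  have \<alpha>: "\<alpha> i \<noteq> 0" for i
    using assms(1) diagonal_in_basis_det[OF assms(2,3)] by (auto simp: GL_def invertible_det_nz)
  have "A\<^sub>1 \<in> carrier GL"
    using \<alpha> diagonal_in_basis_det[OF assms(2,4)] by (auto simp: GL_def invertible_det_nz)
  moreover have "f A\<^sub>1 = 0"
    if f: "f \<in> regular_functions" "\<forall>Y\<in>{A [^]\<^bsub>GL\<^esub> m |m :: int. True}. f Y = 0" for f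
  proof -
    obtain L where L: "\<And>\<phi> D. multiplicative \<phi> \<Longrightarrow> diagonal_in_basis b (\<lambda>i. \<phi> (\<alpha> i)) D \<Longrightarrow>
        f D = (\<Sum>(c, v)\<leftarrow>L. c * \<phi> v)"
      using regular_function_on_diagonal[where \<alpha> = \<alpha>, OF f(1) assms(2) \<alpha>] by blast
    have "(\<Sum>(c, v)\<leftarrow>L. c * v ^ m) = 0" for m :: nat
    proof -
      have "f (A [^]\<^bsub>GL\<^esub> m) = (\<Sum>(c, v)\<leftarrow>L. c * v ^ m)"
        by (rule L) (auto simp: multiplicative_def power_mult_distrib
            intro: diagonal_in_basis_pow[OF assms(3)])
      \<comment> \<open>The natural power belongs to the cyclic group as the integer power with
        exponent \<open>int m\<close>.\<close>
      moreover have "f (A [^]\<^bsub>GL\<^esub> int m) = 0"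
        using f(2) by blast
      ultimately show ?thesis by (simp add: int_pow_int)
    qed
    then have "(\<Sum>(c, v)\<leftarrow>L. c * complex_of_real (cmod v)) = 0"
      by (rule sum_list_exponentials_eq_0)
    also have "(\<Sum>(c, v)\<leftarrow>L. c * complex_of_real (cmod v)) = f A\<^sub>1"
      by (rule L[symmetric]) (auto simp: multiplicative_def norm_mult assms(4))
    finally show ?thesis .
  qed
  moreover have "{A [^]\<^bsub>GL\<^esub> m |m :: int. True} \<subseteq> carrier GL"
    using group.int_pow_closed[OF group_GL assms(1)] by blast
  ultimately show ?thesis
    by (simp only: in_zariski_closure_iff) blast
qed

end
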